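(* Let $m\ge3$ be an integer. For Lebesgue-almost every real number $x\in[0,1]$, every digit $i\in\{1,\dots,m-1\}$ occurs infinitely many times in the continued logarithm representation $(d_k)_{k\ge1}$ of $x$ to base $m$, i.e. the set $\{k\ge1 : d_k=i\}$ is infinite for every $i\in\{1,\dots,m-1\}$.
   Context: For an integer $m\ge3$ and $d\in\{1,\dots,m-1\}$ let $T_d:[0,1]\to[0,1]$, $T_d(x)=\log_m(d+x)$; these maps are contractions of $[0,1]$. For a sequence $(d_k)_{k\ge1}\in\{1,\dots,m-1\}^{\mathbb{N}}$ the continued logarithm to base $m$ is $$[(d_k)]_m=\lim_{n\to\infty}T_{d_1}\circ T_{d_2}\circ\cdots\circ T_{d_n}(0)=\lim_{n\to\infty}\log_m(d_1+\log_m(d_2+\cdots+\log_m(d_n)\cdots)).$$ The limit exists and lies in $[0,1]$. A sequence $(d_k)$ with $[(d_k)]_m=x$ is called a continued logarithm representation of $x$ to base $m$, and its entries $d_k$ are the digits. Every $x\in[0,1]$ has such a representation, and it is unique for all $x$ outside a countable set. *)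

theory Defs
  imports "HOL-Analysis.Analysis"
begin

definition clog_map :: "nat \<Rightarrow> nat \<Rightarrow> real \<Rightarrow> real" where
  "clog_map m d x = log (real m) (real d + x)"

text \<open>Digit sequences are indexed from 1, so the value \<open>d 0\<close> is never used.\<close>

primrec clog_comp :: "nat \<Rightarrow> (nat \<Rightarrow> nat) \<Rightarrow> nat \<Rightarrow> real \<Rightarrow> real" where
  "clog_comp m d 0 = id"
| "clog_comp m d (Suc n) = clog_comp m d n \<circ> clog_map m (d (Suc n))"

definition clog_representation :: "nat \<Rightarrow> (nat \<Rightarrow> nat) \<Rightarrow> real \<Rightarrow> bool" where
  "clog_representation m d x \<longleftrightarrow>
     (\<forall>k\<ge>1. d k \<in> {1..m - 1}) \<and> (\<lambda>n. clog_comp m d n 0) \<longlonglongrightarrow> x"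

text \<open>
  Every point of the unit interval has a representation, so a statement about all
  representations of almost every point is not vacuous.
\<close>

lemma clog_comp_contraction:
  assumes m: "m \<ge> 3" and d: "\<forall>k\<ge>1. 1 \<le> d k" and ab: "0 \<le> a" "a \<le> b"
  shows "clog_comp m d n a \<le> clog_comp m d n b"
    and "clog_comp m d n b - clog_comp m d n a \<le> (1 / ln (real m)) ^ n * (b - a)"
proof -
  have lm: "ln (real m) > 0" using m by simp
  have "clog_comp m d n a \<le> clog_comp m d n b \<and>
        clog_comp m d n b - clog_comp m d n a \<le> (1 / ln (real m)) ^ n * (b - a)"
    using ab
  proof (induction n arbitrary: a b)
    case (Suc n)
    define D where "D = real (d (Suc n))"
    have D: "D \<ge> 1" using d by (simp add: D_def)
    define a' b' where "a' = clog_map m (d (Suc n)) a" and "b' = clog_map m (d (Suc n)) b"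
    have a'': "a' = ln (D + a) / ln (real m)" "b' = ln (D + b) / ln (real m)"
      by (simp_all add: a'_def b'_def clog_map_def D_def log_def)
    have "0 \<le> ln (D + a)" using D Suc.prems by simp
    then have 1: "0 \<le> a'" using lm by (simp add: a'')
    have "ln (D + a) \<le> ln (D + b)" using D Suc.prems by simp
    then have 2: "a' \<le> b'" using lm by (simp add: a'' divide_right_mono)
    have "ln (D + b) - ln (D + a) \<le> (D + b - (D + a)) / (D + a)"
      by (rule ln_diff_le) (use D Suc.prems in auto)
    also have "\<dots> \<le> (b - a) / 1"
      using D Suc.prems by (intro frac_le) auto
    finally have "(ln (D + b) - ln (D + a)) / ln (real m) \<le> (b - a) / ln (real m)"
      using lm by (intro divide_right_mono) auto
    then have 3: "b' - a' \<le> (1 / ln (real m)) * (b - a)"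
      by (simp add: a'' diff_divide_distrib)
    have "(1 / ln (real m)) ^ n * (b' - a') \<le> (1 / ln (real m)) ^ n * ((1 / ln (real m)) * (b - a))"
      using 3 lm by (intro mult_left_mono) auto
    also have "\<dots> = (1 / ln (real m)) ^ Suc n * (b - a)" by (simp only: power_Suc mult_ac)
    finally have 4: "(1 / ln (real m)) ^ n * (b' - a') \<le> (1 / ln (real m)) ^ Suc n * (b - a)" .
    have "clog_comp m d (Suc n) a = clog_comp m d n a'" "clog_comp m d (Suc n) b = clog_comp m d n b'"
      by (simp_all add: a'_def b'_def)
    then show ?case using Suc.IH[OF 1 2] 4 by linarith
  qed simp
  then show "clog_comp m d n a \<le> clog_comp m d n b"
    and "clog_comp m d n b - clog_comp m d n a \<le> (1 / ln (real m)) ^ n * (b - a)" by auto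
qed

lemma clog_representation_exists:
  assumes m: "m \<ge> 3" and x: "x \<in> {0..1}"
  shows "\<exists>d. clog_representation m d x"
proof -
  have m1: "real m > 1" using m by simp
  have step: "\<exists>i\<in>{1..m - 1}. \<exists>z\<in>{0..1}. clog_map m i z = y" if y: "y \<in> {0..1}" for y :: real
  proof -
    define v where "v = real m powr y"
    have v1: "1 \<le> v" using y m1 by (simp add: v_def ge_one_powr_ge_zero)
    have "v \<le> real m powr 1" unfolding v_def using y m1 by (intro powr_mono) auto
    then have vm: "v \<le> real m" using m1 by simp
    define i where "i = min (nat \<lfloor>v\<rfloor>) (m - 1)"
    have f: "real (nat \<lfloor>v\<rfloor>) \<le> v" "v < real (nat \<lfloor>v\<rfloor>) + 1" "1 \<le> nat \<lfloor>v\<rfloor>"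
      using v1 by linarith+
    have m': "real (m - 1) = real m - 1" using m by (simp add: of_nat_diff)
    have i: "i \<in> {1..m - 1}" using f m by (auto simp: i_def)
    have "real i \<le> v" using f by (simp add: i_def min_def split: if_splits)
    moreover have "v \<le> real i + 1" using f vm m' by (auto simp: i_def min_def)
    ultimately have "v - real i \<in> {0..1}" by auto
    moreover have "clog_map m i (v - real i) = y"
      using m1 by (simp add: clog_map_def v_def)
    ultimately show ?thesis using i by blast
  qed
  then obtain \<delta> S where S: "\<And>y. y \<in> {0..1} \<Longrightarrow> \<delta> y \<in> {1..m - 1}"
      "\<And>y. y \<in> {0..1} \<Longrightarrow> S y \<in> {0..1}" "\<And>y. y \<in> {0..1} \<Longrightarrow> clog_map m (\<delta> y) (S y) = y"
    by metis
  define X where "X n = (S ^^ n) x" for n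
  define d where "d k = \<delta> (X (k - 1))" for k
  have X: "X n \<in> {0..1}" for n by (induction n) (use x S(2) in \<open>auto simp: X_def\<close>)
  have XS: "X (Suc n) = S (X n)" for n by (simp add: X_def)
  have d: "\<forall>k\<ge>1. d k \<in> {1..m - 1}" using S(1) X by (simp add: d_def)
  then have d1: "\<forall>k\<ge>1. 1 \<le> d k" by auto
  have eq: "clog_comp m d n (X n) = x" for n
    by (induction n) (use S(3) X in \<open>auto simp: XS d_def\<close>, simp add: X_def)
  have "ln 3 \<le> ln (real m)" using m by simp
  then have "ln (real m) > 1" using ln3_gt_1 by linarith
  then have q: "0 < 1 / ln (real m)" "1 / ln (real m) < 1" by auto
  have "norm (x - clog_comp m d n 0) \<le> (1 / ln (real m)) ^ n" for n
  proof -
    have "0 \<le> X n" "X n \<le> 1" using X[of n] by auto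
    then have "clog_comp m d n 0 \<le> x" "x - clog_comp m d n 0 \<le> (1 / ln (real m)) ^ n * X n"
      using clog_comp_contraction[OF m d1, of 0 "X n" n] eq[of n] by auto
    moreover have "(1 / ln (real m)) ^ n * X n \<le> (1 / ln (real m)) ^ n * 1"
      using \<open>X n \<le> 1\<close> q by (intro mult_left_mono) auto
    ultimately show ?thesis by simp
  qed
  then have "(\<lambda>n. x - clog_comp m d n 0) \<longlonglongrightarrow> 0"
    using q by (intro tendsto_0_le[OF LIMSEQ_realpow_zero[of "1 / ln (real m)"], where K = 1] eventuallyI) auto
  then have "(\<lambda>n. x - (x - clog_comp m d n 0)) \<longlonglongrightarrow> x - 0"
    by (intro tendsto_intros)
  then show ?thesis using d by (auto simp: clog_representation_def)
qed

end

theory Submission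
  imports Defs
begin

text \<open>
  The compositions \<open>T\<^sub>w\<close> have uniformly bounded distortion: \<open>ln (T\<^sub>d)'\<close> is 1-Lipschitz and the maps
  \<open>T\<^sub>d\<close> contract by \<open>q = 1 / ln m < 1\<close>, so \<open>ln (T\<^sub>w)'\<close> is \<open>K\<close>-Lipschitz for the solution
  \<open>K = 1 / (1 - q)\<close> of \<open>q * K + 1 = K\<close>, whatever the word \<open>w\<close>. Hence removing the subinterval of
  digit \<open>i\<close> from any cylinder removes at least a fixed proportion of its length. Iterating, the
  points of a cylinder whose later digits all avoid \<open>i\<close> form a null set, and there are only countably
  many cylinders.
\<close>

text \<open>The prefix is a total function read only at \<open>1..n\<close>, so that it fits
  \<open>clog_comp\<close> and can be lengthened by an update at \<open>Suc n\<close>. The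
  quantifier over \<open>d\<close> admits a point as soon as one of its representations qualifies,
  so leaving these sets controls all representations at once.\<close>

definition avoiding_cylinder :: "nat \<Rightarrow> nat \<Rightarrow> (nat \<Rightarrow> nat) \<Rightarrow> nat \<Rightarrow> real set" where
  "avoiding_cylinder m i w n =
     {x. \<exists>d. clog_representation m d x \<and> (\<forall>k\<in>{1..n}. d k = w k) \<and> (\<forall>k>n. d k \<noteq> i)}"

section \<open>Elementary properties of the digit maps\<close>

lemma clog_comp_cong:
  "(\<And>k. k \<in> {1..n} \<Longrightarrow> d k = w k) \<Longrightarrow> clog_comp m d n = clog_comp m w n"
  by (induction n) auto

lemma ln_base_gt_1:
  assumes "m \<ge> (3::nat)"
  shows "1 < ln (real m)"
proof -
  have "ln 3 \<le> ln (real m)" using assms by simp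
  then show ?thesis using ln3_gt_1 by linarith
qed

lemma clog_map_in_unit:
  assumes m: "m \<ge> 3" and j: "j \<in> {1..m - 1}" and x: "x \<in> {0..1}"
  shows "clog_map m j x \<in> {0..1}"
proof -
  have "real j + 1 \<le> real m"
    using j m by (auto simp: of_nat_diff)
  then have "real j + x \<le> real m" "1 \<le> real j + x" using x j by auto
  then show ?thesis using m by (simp add: clog_map_def)
qed

lemma clog_map_lipschitz:
  assumes m: "m \<ge> 3" and j: "1 \<le> j" and x: "0 \<le> x" and y: "0 \<le> y"
  shows "\<bar>clog_map m j x - clog_map m j y\<bar> \<le> \<bar>x - y\<bar> / ln (real m)"
proof -
  have *: "clog_map m j a \<le> clog_map m j b"
          "clog_map m j b - clog_map m j a \<le> (b - a) / ln (real m)" if "0 \<le> a" "a \<le> b" for a b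
    \<comment> \<open>A constant word of length 1 turns the estimate for compositions into one for a
      single map.\<close>
    using clog_comp_contraction[OF m _ that, of "\<lambda>_. j" 1] j by auto
  show ?thesis
    using *[of x y] *[of y x] x y by (cases "x \<le> y") auto
qed

lemma clog_map_has_derivative:
  assumes m: "m \<ge> 3" and j: "1 \<le> j" and x: "0 \<le> x"
  shows "(clog_map m j has_real_derivative 1 / ((real j + x) * ln (real m))) (at x)"
proof -
  have "((\<lambda>x. ln (real j + x)) has_real_derivative 1 / (real j + x)) (at x)"
    using j x by (auto intro!: derivative_eq_intros)
  from DERIV_cdivide[OF this, of "ln (real m)"] show ?thesis
    by (simp add: clog_map_def[abs_def] log_def)
qed

section \<open>Bounded distortion of the compositions\<close>

text \<open>Quotients of derivatives of one digit map have this form, so this is the exponentiated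
  1-Lipschitz bound on the logarithm of the derivative. It comes from
  \<open>1 + u \<le> exp u\<close> with \<open>u = (y - x) / (a + x)\<close>.\<close>

lemma ratio_le_exp_dist:
  fixes a x y :: real
  assumes "1 \<le> a" "0 \<le> x"
  shows "(a + y) / (a + x) \<le> exp \<bar>x - y\<bar>"
proof -
  have "(a + y) / (a + x) = 1 + (y - x) / (a + x)" using assms by (simp add: field_simps)
  also have "\<dots> \<le> exp ((y - x) / (a + x))" by (rule exp_ge_add_one_self)
  also have "(y - x) / (a + x) \<le> \<bar>x - y\<bar> / 1"
    using assms by (intro frac_le) auto
  finally show ?thesis by simp
qed

text \<open>The induction appends the new map on the inside. It contracts distances by
  \<open>1 / ln (real m)\<close>, which turns the constant \<open>K\<close> of the outer maps into
  \<open>K / ln (real m)\<close>, and its own derivative adds 1; by the choice of \<open>K\<close>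
  the sum is \<open>K\<close> again.\<close>

lemma clog_comp_distortion:
  assumes m: "m \<ge> 3" and w: "\<forall>k\<ge>1. w k \<in> {1..m - 1}"
    and K: "K = 1 / (1 - 1 / ln (real m))"
  shows "\<exists>g. \<forall>x\<in>{0..1}. (clog_comp m w n has_real_derivative g x) (at x) \<and> 0 < g x \<and>
               (\<forall>y\<in>{0..1}. g x \<le> exp (K * \<bar>x - y\<bar>) * g y)"
proof (induction n)
  have lm: "1 < ln (real m)" by (rule ln_base_gt_1[OF m])
  then have K0: "0 < K" and K1: "K / ln (real m) + 1 = K" by (auto simp: K field_simps)
  {
    case 0
    have "\<forall>x\<in>{0..1}. (clog_comp m w 0 has_real_derivative 1) (at x) \<and> (0::real) < 1 \<and>
               (\<forall>y\<in>{0..1}. 1 \<le> exp (K * \<bar>x - y\<bar>) * 1)"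
      using K0 by (auto simp: id_def)
    then show ?case by (intro exI[of _ "\<lambda>_. 1"])
  next
    case (Suc n)
    then obtain g where g: "\<And>x. x \<in> {0..1} \<Longrightarrow> (clog_comp m w n has_real_derivative g x) (at x)"
      "\<And>x. x \<in> {0..1} \<Longrightarrow> 0 < g x"
      "\<And>x y. x \<in> {0..1} \<Longrightarrow> y \<in> {0..1} \<Longrightarrow> g x \<le> exp (K * \<bar>x - y\<bar>) * g y"
      by metis
    define T where "T = clog_map m (w (Suc n))"
    define D where "D = real (w (Suc n))"
    have wn: "w (Suc n) \<in> {1..m - 1}" using w by simp
    then have D: "1 \<le> D" by (simp add: D_def)
    define h where "h x = 1 / ((D + x) * ln (real m))" for x
    have T: "T x \<in> {0..1}" if "x \<in> {0..1}" for x
      unfolding T_def using clog_map_in_unit[OF m wn that] .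
    have dT: "(T has_real_derivative h x) (at x)" if "x \<in> {0..1}" for x
      using clog_map_has_derivative[OF m, of "w (Suc n)" x] that wn by (simp add: T_def h_def D_def)
    have h0: "0 < h x" if "x \<in> {0..1}" for x
      using that D lm by (simp add: h_def)
    have step: "g (T x) * h x \<le> exp (K * \<bar>x - y\<bar>) * (g (T y) * h y)"
      if x: "x \<in> {0..1}" and y: "y \<in> {0..1}" for x y
    proof -
      have "K * \<bar>T x - T y\<bar> \<le> K * (\<bar>x - y\<bar> / ln (real m))"
        using clog_map_lipschitz[OF m, of "w (Suc n)" x y] K0 x y wn
        by (intro mult_left_mono) (auto simp: T_def)
      then have "exp (K * \<bar>T x - T y\<bar>) * g (T y) \<le> exp (K / ln (real m) * \<bar>x - y\<bar>) * g (T y)"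
        using g(2)[OF T[OF y]] by (intro mult_right_mono) auto
      then have 1: "g (T x) \<le> exp (K / ln (real m) * \<bar>x - y\<bar>) * g (T y)"
        using g(3)[OF T[OF x] T[OF y]] by linarith
      have "h x = (D + y) / (D + x) * h y"
        using D x y by (simp add: h_def)
      also have "\<dots> \<le> exp \<bar>x - y\<bar> * h y"
        using ratio_le_exp_dist[OF D, of x y] x h0[OF y] by (intro mult_right_mono) auto
      finally have 2: "h x \<le> exp \<bar>x - y\<bar> * h y" .
      have "K * \<bar>x - y\<bar> = K / ln (real m) * \<bar>x - y\<bar> + \<bar>x - y\<bar>"
        by (subst K1[symmetric]) (simp add: algebra_simps)
      then have e: "exp (K * \<bar>x - y\<bar>) = exp (K / ln (real m) * \<bar>x - y\<bar>) * exp \<bar>x - y\<bar>"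
        by (simp only: exp_add)
      have "g (T x) * h x \<le> (exp (K / ln (real m) * \<bar>x - y\<bar>) * g (T y)) * (exp \<bar>x - y\<bar> * h y)"
        using 1 2 g(2)[OF T[OF y]] h0[OF x] by (intro mult_mono) auto
      then show ?thesis by (simp add: e mult_ac)
    qed
    have "(clog_comp m w (Suc n) has_real_derivative g (T x) * h x) (at x)" if "x \<in> {0..1}" for x
      using DERIV_chain[OF g(1)[OF T[OF that]] dT[OF that]] by (simp add: T_def)
    then show ?case
      using step g(2) T h0
      by (intro exI[of _ "\<lambda>x. g (T x) * h x"]) (auto simp del: clog_comp.simps)
  }
qed

text \<open>The mean value theorem on \<open>[a, b]\<close> and on \<open>[0, 1]\<close> yields
  derivatives at two points of distance at most 1, and these differ by a factor of at most
  \<open>exp K\<close>, uniformly in \<open>w\<close> and \<open>n\<close>.\<close>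

lemma clog_comp_proportion:
  assumes m: "m \<ge> 3" and w: "\<forall>k\<ge>1. w k \<in> {1..m - 1}" and ab: "0 \<le> a" "a < b" "b \<le> 1"
    and K: "K = 1 / (1 - 1 / ln (real m))"
  shows "exp (- K) * (b - a) * (clog_comp m w n 1 - clog_comp m w n 0)
           \<le> clog_comp m w n b - clog_comp m w n a"
proof -
  obtain g where g: "\<And>x. x \<in> {0..1} \<Longrightarrow> (clog_comp m w n has_real_derivative g x) (at x)"
      "\<And>x. x \<in> {0..1} \<Longrightarrow> 0 < g x"
      "\<And>x y. x \<in> {0..1} \<Longrightarrow> y \<in> {0..1} \<Longrightarrow> g x \<le> exp (K * \<bar>x - y\<bar>) * g y"
    using clog_comp_distortion[OF m w K, of n] by metis
  have K0: "0 < K" using ln_base_gt_1[OF m] by (simp add: K)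
  obtain s where s: "a < s" "s < b" "clog_comp m w n b - clog_comp m w n a = (b - a) * g s"
    using MVT2[OF ab(2), of "clog_comp m w n" g] g(1) ab by auto
  obtain t where t: "0 < t" "t < 1" "clog_comp m w n 1 - clog_comp m w n 0 = (1 - 0) * g t"
    using MVT2[of 0 1 "clog_comp m w n" g] g(1) by auto
  have "g t \<le> exp (K * \<bar>t - s\<bar>) * g s" using g(3) s t ab by auto
  also have "\<dots> \<le> exp (K * 1) * g s"
    using K0 s t ab g(2)[of s] by (intro mult_right_mono) auto
  finally have "exp (- K) * g t \<le> g s"
    by (simp add: exp_minus field_simps)
  then have "(b - a) * (exp (- K) * g t) \<le> (b - a) * g s" using ab by (intro mult_left_mono) auto
  then show ?thesis using s(3) t(3) by (simp add: mult_ac)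
qed

section \<open>Cylinders and their subdivision by the next digit\<close>

text \<open>Neighbouring digit intervals share an endpoint, since
  \<open>clog_map m j 1 = clog_map m (Suc j) 0\<close>; the outermost endpoints are
  \<open>log m 1 = 0\<close> and \<open>log m m = 1\<close>.\<close>

lemma clog_map_subintervals_telescope:
  assumes m: "m \<ge> 3"
  shows "(\<Sum>j\<in>{1..m - 1}. f (clog_map m j 1) - f (clog_map m j 0)) = f 1 - (f 0 :: real)"
proof -
  have "(\<Sum>j\<in>{1..m - 1}. f (clog_map m j 1) - f (clog_map m j 0)) =
        (\<Sum>j\<in>{1..<m}. f (log (real m) (real (Suc j))) - f (log (real m) (real j)))"
    using m by (intro sum.cong) (auto simp: clog_map_def add_ac)
  also have "\<dots> = f (log (real m) (real m)) - f (log (real m) (real 1))"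
    using m by (subst sum_Suc_diff'[where f = "\<lambda>j. f (log (real m) (real j))"]) auto
  finally show ?thesis using m by simp
qed

lemma clog_comp_tail_in_unit:
  assumes m: "m \<ge> 3" and d: "\<forall>k\<ge>1. d k \<in> {1..m - 1}"
  shows "\<exists>z\<in>{0..1}. clog_comp m d (n + k) 0 = clog_comp m d n z"
proof -
  \<comment> \<open>The start point is general because the induction absorbs the innermost map into
    it.\<close>
  have "y \<in> {0..1} \<Longrightarrow> \<exists>z\<in>{0..1}. clog_comp m d (n + k) y = clog_comp m d n z" for y
  proof (induction k arbitrary: y)
    case (Suc k)
    then show ?case
      using Suc.IH[OF clog_map_in_unit[OF m _ Suc.prems, of "d (Suc (n + k))"]] d by auto
  qed auto
  then show ?thesis by auto
qed

text \<open>From index \<open>n\<close> on, the approximants are values of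
  \<open>clog_comp m w n\<close> on the unit interval, hence lie between its endpoint values by
  monotonicity; the closed interval keeps their limit.\<close>

lemma avoiding_cylinder_subset:
  assumes m: "m \<ge> 3"
  shows "avoiding_cylinder m i w n \<subseteq> {clog_comp m w n 0..clog_comp m w n 1}"
proof
  fix x assume "x \<in> avoiding_cylinder m i w n"
  then obtain d where d: "\<forall>k\<ge>1. d k \<in> {1..m - 1}" "(\<lambda>n. clog_comp m d n 0) \<longlonglongrightarrow> x"
    "\<forall>k\<in>{1..n}. d k = w k"
    by (auto simp: avoiding_cylinder_def clog_representation_def)
  have eq: "clog_comp m d n = clog_comp m w n" using d(3) by (intro clog_comp_cong) auto
  have d1: "\<forall>k\<ge>1. 1 \<le> d k" using d(1) by auto
  have bnd: "clog_comp m d (n + k) 0 \<in> {clog_comp m w n 0..clog_comp m w n 1}" for k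
  proof -
    obtain z where z: "z \<in> {0..1}" "clog_comp m d (n + k) 0 = clog_comp m d n z"
      using clog_comp_tail_in_unit[OF m d(1)] by blast
    then show ?thesis
      using clog_comp_contraction(1)[OF m d1, of 0 z n] clog_comp_contraction(1)[OF m d1, of z 1 n] eq
      by auto
  qed
  have "(\<lambda>k. clog_comp m d (n + k) 0) \<longlonglongrightarrow> x"
    using LIMSEQ_ignore_initial_segment[OF d(2), of n] by (simp add: add.commute)
  then show "x \<in> {clog_comp m w n 0..clog_comp m w n 1}"
    by (rule closed_sequentially[OF closed_atLeastAtMost bnd])
qed

lemma avoiding_cylinder_split:
  "avoiding_cylinder m i w n
     \<subseteq> (\<Union>j\<in>{1..m - 1} - {i}. avoiding_cylinder m i (w(Suc n := j)) (Suc n))"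
proof
  fix x assume "x \<in> avoiding_cylinder m i w n"
  then obtain d where d: "clog_representation m d x" "\<forall>k\<in>{1..n}. d k = w k" "\<forall>k>n. d k \<noteq> i"
    by (auto simp: avoiding_cylinder_def)
  have "d (Suc n) \<in> {1..m - 1} - {i}" using d by (auto simp: clog_representation_def)
  moreover have "x \<in> avoiding_cylinder m i (w(Suc n := d (Suc n))) (Suc n)"
    unfolding avoiding_cylinder_def using d by (intro CollectI exI[of _ d]) auto
  ultimately show "x \<in> (\<Union>j\<in>{1..m - 1} - {i}. avoiding_cylinder m i (w(Suc n := j)) (Suc n))"
    by blast
qed

section \<open>Measure of the points avoiding a digit\<close>

text \<open>\<open>N\<close> counts refinements: each one drops the subinterval of digit
  \<open>i\<close> from every current cylinder and so costs a factor \<open>1 - c\<close>. A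
  measurable cover \<open>B\<close> is estimated, which leaves the measurability of the avoiding set
  itself open.\<close>

lemma avoiding_cylinder_cover:
  assumes m: "m \<ge> 3" and w: "\<forall>k\<ge>1. w k \<in> {1..m - 1}" and i: "i \<in> {1..m - 1}"
    and c: "c = exp (- (1 / (1 - 1 / ln (real m)))) * (clog_map m i 1 - clog_map m i 0)"
    and c1: "c \<le> 1"
  shows "\<exists>B. B \<in> lmeasurable \<and> avoiding_cylinder m i w n \<subseteq> B \<and>
           measure lebesgue B \<le> (1 - c) ^ N * (clog_comp m w n 1 - clog_comp m w n 0)"
  using w
proof (induction N arbitrary: w n)
  case 0
  have "clog_comp m w n 0 \<le> clog_comp m w n 1"
    using clog_comp_contraction(1)[OF m, of w 0 1 n] 0 by auto
  then show ?case
    using avoiding_cylinder_subset[OF m, of i w n]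
    by (intro exI[of _ "{clog_comp m w n 0..clog_comp m w n 1}"]) auto
next
  case (Suc N)
  define J where "J = {1..m - 1} - {i}"
  define f where "f = clog_comp m w n"
  have f: "clog_comp m (w(Suc n := j)) (Suc n) = f \<circ> clog_map m j" for j
    using clog_comp_cong[of n "w(Suc n := j)" w m] by (simp add: f_def)
  have "\<forall>j\<in>J. \<exists>B. B \<in> lmeasurable \<and> avoiding_cylinder m i (w(Suc n := j)) (Suc n) \<subseteq> B \<and>
           measure lebesgue B \<le> (1 - c) ^ N * (f (clog_map m j 1) - f (clog_map m j 0))"
  proof
    fix j assume "j \<in> J"
    then have "\<forall>k\<ge>1. (w(Suc n := j)) k \<in> {1..m - 1}" using Suc.prems by (auto simp: J_def)
    then show "\<exists>B. B \<in> lmeasurable \<and> avoiding_cylinder m i (w(Suc n := j)) (Suc n) \<subseteq> B \<and>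
           measure lebesgue B \<le> (1 - c) ^ N * (f (clog_map m j 1) - f (clog_map m j 0))"
      using Suc.IH[of "w(Suc n := j)" "Suc n"] unfolding f o_apply by blast
  qed
  then obtain B where B: "\<And>j. j \<in> J \<Longrightarrow> B j \<in> lmeasurable"
      "\<And>j. j \<in> J \<Longrightarrow> avoiding_cylinder m i (w(Suc n := j)) (Suc n) \<subseteq> B j"
      "\<And>j. j \<in> J \<Longrightarrow> measure lebesgue (B j) \<le> (1 - c) ^ N * (f (clog_map m j 1) - f (clog_map m j 0))"
    by metis
  have finJ: "finite J" by (simp add: J_def)
  have "measure lebesgue (\<Union>j\<in>J. B j) \<le> (\<Sum>j\<in>J. measure lebesgue (B j))"
    using finJ B(1) by (intro measure_UNION_le) auto
  also have "\<dots> \<le> (\<Sum>j\<in>J. (1 - c) ^ N * (f (clog_map m j 1) - f (clog_map m j 0)))"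
    using B(3) by (intro sum_mono) auto
  also have "\<dots> = (1 - c) ^ N * (\<Sum>j\<in>J. f (clog_map m j 1) - f (clog_map m j 0))"
    by (simp add: sum_distrib_left)
  \<comment> \<open>Over all digits the lengths telescope to the whole cylinder; only the one of
    \<open>i\<close> is missing.\<close>
  also have "(\<Sum>j\<in>J. f (clog_map m j 1) - f (clog_map m j 0)) =
      f 1 - f 0 - (f (clog_map m i 1) - f (clog_map m i 0))"
    unfolding J_def using i clog_map_subintervals_telescope[OF m, of f] by (simp add: sum_diff1)
  also have "(1 - c) ^ N * \<dots> \<le> (1 - c) ^ N * ((1 - c) * (f 1 - f 0))"
  proof (intro mult_left_mono)
    have "clog_map m i 0 < clog_map m i 1" using i m by (simp add: clog_map_def)
    \<comment> \<open>The interval of digit \<open>i\<close> has image of length at least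
      \<open>c * (f 1 - f 0)\<close>, by the distortion bound.\<close>
    then show "f 1 - f 0 - (f (clog_map m i 1) - f (clog_map m i 0)) \<le> (1 - c) * (f 1 - f 0)"
      using clog_comp_proportion[OF m Suc.prems _ _ _ refl, of "clog_map m i 0" "clog_map m i 1" n]
        clog_map_in_unit[OF m i, of 0] clog_map_in_unit[OF m i, of 1]
      by (simp add: c f_def algebra_simps)
  qed (use c1 in auto)
  finally have "measure lebesgue (\<Union>j\<in>J. B j) \<le> (1 - c) ^ Suc N * (f 1 - f 0)"
    by (simp add: mult_ac)
  moreover have "(\<Union>j\<in>J. B j) \<in> lmeasurable" using finJ B(1) by (intro fmeasurable.finite_UN) auto
  moreover have "avoiding_cylinder m i w n \<subseteq> (\<Union>j\<in>J. B j)"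
    using avoiding_cylinder_split[of m i w n] B(2) unfolding J_def by blast
  ultimately show ?case unfolding f_def by blast
qed

lemma negligible_avoiding_cylinder:
  assumes m: "m \<ge> 3" and w: "\<forall>k\<ge>1. w k \<in> {1..m - 1}" and i: "i \<in> {1..m - 1}"
  shows "negligible (avoiding_cylinder m i w n)"
  unfolding negligible_outer_le
proof (intro allI impI)
  fix e :: real assume e: "0 < e"
  define c where "c = exp (- (1 / (1 - 1 / ln (real m)))) * (clog_map m i 1 - clog_map m i 0)"
  have "clog_map m i 0 < clog_map m i 1" using i m by (simp add: clog_map_def)
  then have c0: "0 < c" by (simp add: c_def)
  have "c \<le> 1 * 1"
    unfolding c_def using clog_map_in_unit[OF m i, of 0] clog_map_in_unit[OF m i, of 1]
      ln_base_gt_1[OF m] \<open>clog_map m i 0 < clog_map m i 1\<close>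
    by (intro mult_mono) auto
  then have c1: "c \<le> 1" by simp
  define L where "L = clog_comp m w n 1 - clog_comp m w n 0"
  have "(\<lambda>N. (1 - c) ^ N * L) \<longlonglongrightarrow> 0 * L"
    using c0 c1 by (intro tendsto_mult_right LIMSEQ_realpow_zero) auto
  then have "\<forall>\<^sub>F N in sequentially. (1 - c) ^ N * L < e"
    using e by (intro order_tendstoD(2)) auto
  then obtain N where N: "(1 - c) ^ N * L < e"
    by (auto simp: eventually_sequentially)
  obtain B where "B \<in> lmeasurable" "avoiding_cylinder m i w n \<subseteq> B"
      "measure lebesgue B \<le> (1 - c) ^ N * L"
    using avoiding_cylinder_cover[OF m w i c_def c1, of n N] unfolding L_def by blast
  moreover from this N have "measure lebesgue B \<le> e" by linarith
  ultimately show "\<exists>T. avoiding_cylinder m i w n \<subseteq> T \<and> T \<in> lmeasurable \<and> measure lebesgue T \<le> e"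
    by blast
qed

theorem theorem2p1:
  fixes m :: nat
  assumes "m \<ge> 3"
  shows "AE x in lebesgue_on {0..1::real}.
           \<forall>d. clog_representation m d x \<longrightarrow>
             (\<forall>i\<in>{1..m - 1}. infinite {k. k \<ge> 1 \<and> d k = i})"
proof -
  \<comment> \<open>Lists give countably many prefixes. List positions start at 0 and digits at 1,
    hence \<open>k - 1\<close>; the padding 1 is a legal digit, so \<open>W l\<close> is a digit
    sequence.\<close>
  define W where "W l k = (if k \<in> {1..length l} then l ! (k - 1) else 1)" for l :: "nat list" and k
  define N where "N = (\<Union>i\<in>{1..m - 1}. \<Union>l\<in>lists {1..m - 1}. avoiding_cylinder m i (W l) (length l))"
  have W: "\<forall>k\<ge>1. W l k \<in> {1..m - 1}" if "l \<in> lists {1..m - 1}" for l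
  proof (intro allI impI)
    fix k :: nat assume k: "1 \<le> k"
    show "W l k \<in> {1..m - 1}"
    proof (cases "k \<le> length l")
      case True
      then have "l ! (k - 1) \<in> set l" using k by (intro nth_mem) auto
      then have "l ! (k - 1) \<in> {1..m - 1}" using that by (auto simp: in_lists_conv_set)
      then show ?thesis using True k by (auto simp: W_def)
    qed (use assms in \<open>auto simp: W_def\<close>)
  qed
  have "negligible N"
  proof -
    have "negligible (\<Union>l\<in>lists {1..m - 1}. avoiding_cylinder m i (W l) (length l))"
      if "i \<in> {1..m - 1}" for i
      by (intro negligible_countable_Union countable_image)
         (use negligible_avoiding_cylinder[OF assms W that] in blast)+
    then show ?thesis unfolding N_def by (intro negligible_Union) auto
  qed
  then have ae: "AE x in lebesgue. x \<notin> N"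
    by (intro AE_not_in) (simp add: negligible_iff_null_sets)
  have good: "infinite {k. k \<ge> 1 \<and> d k = i}"
    if x: "x \<notin> N" and d: "clog_representation m d x" and i: "i \<in> {1..m - 1}" for x d i
  proof
    assume "finite {k. k \<ge> 1 \<and> d k = i}"
    \<comment> \<open>Beyond the last occurrence of \<open>i\<close> the representation avoids
      \<open>i\<close>, so its first \<open>n\<close> digits name a cylinder in the union
      \<open>N\<close>.\<close>
    then obtain n where "\<forall>k\<in>{k. k \<ge> 1 \<and> d k = i}. k \<le> n"
      unfolding finite_nat_set_iff_bounded_le by blast
    then have n: "\<And>k. k \<ge> 1 \<Longrightarrow> d k = i \<Longrightarrow> k \<le> n" by blast
    define l where "l = map d [1..<Suc n]"
    have digits: "\<forall>k\<ge>1. d k \<in> {1..m - 1}" using d unfolding clog_representation_def by blast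
    then have "l \<in> lists {1..m - 1}" unfolding l_def in_lists_conv_set set_map set_upt by auto
    moreover have "length l = n" by (simp add: l_def del: upt_Suc)
    moreover have "d k = W l k" if "k \<in> {1..n}" for k
      using that by (auto simp: l_def W_def nth_append simp del: upt_Suc)
    moreover have "d k \<noteq> i" if "k > n" for k
      using n[of k] that by auto
    ultimately have "x \<in> avoiding_cylinder m i (W l) (length l)"
      unfolding avoiding_cylinder_def using d by blast
    then have "x \<in> N" unfolding N_def using i \<open>l \<in> lists {1..m - 1}\<close> by blast
    then show False using x by simp
  qed
  have "AE x in lebesgue. x \<in> {0..1} \<longrightarrow> (\<forall>d. clog_representation m d x \<longrightarrow>
             (\<forall>i\<in>{1..m - 1}. infinite {k. k \<ge> 1 \<and> d k = i}))"
    using ae by (rule AE_mp) (intro AE_I2 impI allI ballI good)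
  moreover have "{0..1::real} \<inter> space lebesgue \<in> sets lebesgue" by simp
  ultimately show ?thesis by (simp only: AE_restrict_space_iff)
qed

end
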